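(* Let $S$ be a semigroup and let $T$ be a subsemigroup of $S$ such that the set $S\setminus T$ is finite. Then $S$ has a finite complete rewriting system if and only if $T$ has a finite complete rewriting system.
   Context: Semigroups and subsemigroups are nonempty. For a non-empty set $A$, $A^+$ and $A^*$ denote the free semigroup and the free monoid on $A$. A rewriting system $R$ over $A$ is a set of rules $U\to V$, i.e. a subset of $A^+\times A^+$. Write $W_1\to_R W_2$ if $W_1=Z_1XZ_2$ and $W_2=Z_1YZ_2$ for some $Z_1,Z_2\in A^*$ and some rule $X\to Y$ in $R$. The relation $\to_R^*$ is the reflexive transitive closure of $\to_R$, and $\leftrightarrow_R^*$ is its reflexive symmetric transitive closure, which is a congruence on $A^+$. A semigroup is presented by $[A;R]$ (equivalently, $[A;R]$ is a semigroup presentation for it) if it is isomorphic to $A^+/\leftrightarrow_R^*$. $R$ is Noetherian if there is no infinite sequence $W_1\to_R W_2\to_R W_3\to_R\cdots$. $R$ is confluent if whenever $U\to_R^*V$ and $U\to_R^*W$ there is $X\in A^+$ with $V\to_R^*X$ and $W\to_R^*X$. $R$ is complete if it is Noetherian and confluent. A semigroup has a finite complete rewriting system if it has a semigroup presentation $[A;R]$ with $A$ and $R$ both finite and $R$ complete. *)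

theory Defs
  imports Main
begin

definition subsemigroup :: "'a::semigroup_mult set \<Rightarrow> bool" where
  "subsemigroup T \<longleftrightarrow> T \<noteq> {} \<and> (\<forall>x\<in>T. \<forall>y\<in>T. x * y \<in> T)"

text \<open>The underlying set of the free semigroup on \<open>A\<close>; the free monoid is \<open>lists A\<close>.
  The product is concatenation.\<close>

definition words :: "'b set \<Rightarrow> 'b list set" where
  "words A = lists A - {[]}"

definition rewriting_system :: "'b set \<Rightarrow> ('b list \<times> 'b list) set \<Rightarrow> bool" where
  "rewriting_system A R \<longleftrightarrow> R \<subseteq> words A \<times> words A"

definition rstep :: "'b set \<Rightarrow> ('b list \<times> 'b list) set \<Rightarrow> ('b list \<times> 'b list) set" where
  "rstep A R = {(Z1 @ X @ Z2, Z1 @ Y @ Z2) | Z1 Z2 X Y.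
     Z1 \<in> lists A \<and> Z2 \<in> lists A \<and> (X, Y) \<in> R}"

text \<open>The reflexive symmetric transitive closure of \<open>rstep A R\<close> as a relation on \<open>words A\<close>.
  The restriction is needed because \<open>\<^sup>*\<close> is reflexive on the whole list type.\<close>

definition rcong :: "'b set \<Rightarrow> ('b list \<times> 'b list) set \<Rightarrow> ('b list \<times> 'b list) set" where
  "rcong A R = (rstep A R \<union> (rstep A R)\<inverse>)\<^sup>* \<inter> words A \<times> words A"

definition noetherian :: "'b set \<Rightarrow> ('b list \<times> 'b list) set \<Rightarrow> bool" where
  "noetherian A R \<longleftrightarrow> \<not> (\<exists>W :: nat \<Rightarrow> 'b list. \<forall>i. (W i, W (Suc i)) \<in> rstep A R)"

definition confluent :: "'b set \<Rightarrow> ('b list \<times> 'b list) set \<Rightarrow> bool" where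
  "confluent A R \<longleftrightarrow>
     (\<forall>U\<in>words A. \<forall>V\<in>words A. \<forall>W\<in>words A.
        (U, V) \<in> (rstep A R)\<^sup>* \<and> (U, W) \<in> (rstep A R)\<^sup>* \<longrightarrow>
        (\<exists>X\<in>words A. (V, X) \<in> (rstep A R)\<^sup>* \<and> (W, X) \<in> (rstep A R)\<^sup>*))"

definition complete_rs :: "'b set \<Rightarrow> ('b list \<times> 'b list) set \<Rightarrow> bool" where
  "complete_rs A R \<longleftrightarrow> noetherian A R \<and> confluent A R"

text \<open>Multiplication of congruence classes. As \<open>rcong A R\<close> is a congruence, all members of the
  union coincide, so this is the class of \<open>x @ y\<close> for any representatives \<open>x\<close>, \<open>y\<close>.\<close>

definition class_mult ::
    "'b set \<Rightarrow> ('b list \<times> 'b list) set \<Rightarrow> 'b list set \<Rightarrow> 'b list set \<Rightarrow> 'b list set" where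
  "class_mult A R X Y = (\<Union>x\<in>X. \<Union>y\<in>Y. rcong A R `` {x @ y})"

text \<open>\<open>T\<close>, a subsemigroup of the ambient semigroup \<open>'a\<close> (possibly all of it), is isomorphic to
  the quotient of the free semigroup on \<open>A\<close> by \<open>rcong A R\<close>.\<close>

definition presented_by ::
    "'a::semigroup_mult set \<Rightarrow> 'b set \<Rightarrow> ('b list \<times> 'b list) set \<Rightarrow> bool" where
  "presented_by T A R \<longleftrightarrow>
     (\<exists>\<phi>. bij_betw \<phi> (words A // rcong A R) T \<and>
          (\<forall>X \<in> words A // rcong A R. \<forall>Y \<in> words A // rcong A R.
             \<phi> (class_mult A R X Y) = \<phi> X * \<phi> Y))"

text \<open>Letters are natural numbers because HOL cannot quantify over the letter type. This is no
  restriction, since the alphabet is finite and can be renamed.\<close>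

definition has_finite_complete_rs :: "'a::semigroup_mult set \<Rightarrow> bool" where
  "has_finite_complete_rs T \<longleftrightarrow>
     (\<exists>(A :: nat set) R. A \<noteq> {} \<and> finite A \<and> finite R \<and> rewriting_system A R \<and>
        presented_by T A R \<and> complete_rs A R)"

end

theory Submission
  imports Defs
begin

text \<open>
  A finite complete rewriting system amounts to a finite terminating set of sound rules such that
  every element of the semigroup is the value of exactly one irreducible word.

  Given such a system for \<open>T\<close>, add the finitely many elements outside \<open>T\<close> as letters, together with
  rules that replace each pair of letters, at least one of them new, by a word for its product. The
  irreducible words are then the single new letters and the old irreducible words. For termination,
  cut a word at its new letters: a step that keeps their number rewrites one of the pieces or deletes
  a letter at its end.

  Given such a system \<open>R\<close> over \<open>A\<close> for the whole semigroup, only finitely many irreducible words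
  have a value outside \<open>T\<close>, so there is an \<open>N\<close> such that all irreducible words longer than \<open>N\<close>
  have a value in \<open>T\<close>. Hence the irreducible words of length at most \<open>2N + 2\<close> with value in \<open>T\<close>
  generate \<open>T\<close>. They are the new letters (blocks). Factorise an irreducible word over them greedily,
  each block as short as possible. The rules replace each short sequence of blocks by the greedy
  factorisation of the normal form of its concatenation. A step either rewrites the underlying word
  over \<open>A\<close> or makes the factorisation of the same word lexicographically smaller. For \<open>N\<close> large enough,
  both the irreducibility of the underlying word and the greediness of its factorisation can be
  checked on \<open>N + 1\<close> consecutive blocks.
\<close>

section \<open>Rewriting systems and evaluation of words\<close>

fun word_prod :: "('b \<Rightarrow> 'a::semigroup_mult) \<Rightarrow> 'b list \<Rightarrow> 'a" where
  "word_prod \<psi> [] = undefined"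
| "word_prod \<psi> [a] = \<psi> a"
| "word_prod \<psi> (a # b # w) = \<psi> a * word_prod \<psi> (b # w)"

lemma word_prod_Cons: "w \<noteq> [] \<Longrightarrow> word_prod \<psi> (a # w) = \<psi> a * word_prod \<psi> w"
  by (cases w) auto

lemma word_prod_append:
  "u \<noteq> [] \<Longrightarrow> v \<noteq> [] \<Longrightarrow> word_prod \<psi> (u @ v) = word_prod \<psi> u * word_prod \<psi> v"
proof (induction u)
  case (Cons a u)
  then show ?case
    by (cases "u = []") (auto simp: word_prod_Cons mult.assoc)
qed simp

lemma word_prod_map: "w \<noteq> [] \<Longrightarrow> word_prod \<psi> (map f w) = word_prod (\<psi> \<circ> f) w"
  by (induction w rule: induct_list012) auto

lemma word_prod_concat:
  "\<beta> \<noteq> [] \<Longrightarrow> [] \<notin> set \<beta> \<Longrightarrow> word_prod (word_prod \<psi>) \<beta> = word_prod \<psi> (concat \<beta>)"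
  by (induction \<beta> rule: induct_list012) (auto simp: word_prod_append)

lemma in_words_iff: "w \<in> words A \<longleftrightarrow> w \<noteq> [] \<and> set w \<subseteq> A"
  by (auto simp: words_def)

lemma rstepI: "(X, Y) \<in> R \<Longrightarrow> set p \<subseteq> A \<Longrightarrow> set q \<subseteq> A \<Longrightarrow> (p @ X @ q, p @ Y @ q) \<in> rstep A R"
  unfolding rstep_def by fastforce

lemma rstepE:
  assumes "(u, v) \<in> rstep A R"
  obtains p q X Y where "u = p @ X @ q" "v = p @ Y @ q" "(X, Y) \<in> R" "set p \<subseteq> A" "set q \<subseteq> A"
  using assms unfolding rstep_def by fast

lemma rstep_context:
  assumes "(u, v) \<in> rstep A R" "set p \<subseteq> A" "set q \<subseteq> A"
  shows "(p @ u @ q, p @ v @ q) \<in> rstep A R"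
proof -
  obtain p' q' X Y where "u = p' @ X @ q'" "v = p' @ Y @ q'" "(X, Y) \<in> R" "set p' \<subseteq> A" "set q' \<subseteq> A"
    using assms(1) by (rule rstepE)
  then show ?thesis
    using rstepI[of X Y R "p @ p'" A "q' @ q"] assms by simp
qed

lemma rstep_words:
  assumes "rewriting_system A R" "(u, v) \<in> rstep A R"
  shows "u \<in> words A \<and> v \<in> words A"
proof -
  obtain p q X Y where *: "u = p @ X @ q" "v = p @ Y @ q" "(X, Y) \<in> R" "set p \<subseteq> A" "set q \<subseteq> A"
    using assms(2) by (rule rstepE)
  moreover have "X \<in> words A" "Y \<in> words A"
    using *(3) assms(1) by (auto simp: rewriting_system_def)
  ultimately show ?thesis by (simp add: in_words_iff)
qed

lemma rsteps_words:
  "(u, v) \<in> (rstep A R)\<^sup>* \<Longrightarrow> rewriting_system A R \<Longrightarrow> u \<in> words A \<Longrightarrow> v \<in> words A"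
  by (induction rule: rtrancl_induct) (auto dest: rstep_words)

definition normal_words :: "'b set \<Rightarrow> ('b list \<times> 'b list) set \<Rightarrow> 'b list set" where
  "normal_words A R = words A - Domain (rstep A R)"

lemma normal_words_factor:
  assumes "p @ w @ q \<in> normal_words A R" "w \<noteq> []"
  shows "w \<in> normal_words A R"
  using assms unfolding normal_words_def
  by (auto simp: in_words_iff dest: rstep_context[of w _ A R p q])

text \<open>Completeness without congruence classes: the value of a word determines its normal form.\<close>

locale complete_presentation =
  fixes T :: "'a::semigroup_mult set"
    and A :: "'b set"
    and R :: "('b list \<times> 'b list) set"
    and \<psi> :: "'b \<Rightarrow> 'a"
  assumes finite_letters: "finite A"
    and finite_rules: "finite R"
    and rules: "rewriting_system A R"
    and wf_step: "wf ((rstep A R)\<inverse>)"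
    and sound_rule: "(X, Y) \<in> R \<Longrightarrow> word_prod \<psi> X = word_prod \<psi> Y"
    and surj: "word_prod \<psi> ` words A = T"
    and inj: "inj_on (word_prod \<psi>) (normal_words A R)"
begin

lemma sound_step:
  assumes "(u, v) \<in> rstep A R"
  shows "word_prod \<psi> u = word_prod \<psi> v"
proof -
  obtain p q X Y where *: "u = p @ X @ q" "v = p @ Y @ q" "(X, Y) \<in> R"
    using assms by (rule rstepE)
  with rules have "X \<noteq> []" "Y \<noteq> []"
    by (auto simp: rewriting_system_def in_words_iff)
  with * sound_rule[OF *(3)] show ?thesis
    by (cases "p = []"; cases "q = []") (auto simp: word_prod_append)
qed

lemma sound_steps: "(u, v) \<in> (rstep A R)\<^sup>* \<Longrightarrow> word_prod \<psi> u = word_prod \<psi> v"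
  by (induction rule: rtrancl_induct) (auto dest: sound_step)

lemma ex_normal:
  assumes "w \<in> words A"
  shows "\<exists>v\<in>normal_words A R. (w, v) \<in> (rstep A R)\<^sup>*"
  using wf_step assms
proof (induction w rule: wf_induct_rule)
  case (less w)
  show ?case
  proof (cases "w \<in> Domain (rstep A R)")
    case True
    then obtain v where v: "(w, v) \<in> rstep A R" by auto
    then have "v \<in> words A" using rstep_words[OF rules] by blast
    with less.IH[of v] v obtain x where "x \<in> normal_words A R" "(v, x) \<in> (rstep A R)\<^sup>*" by auto
    with v show ?thesis by (meson converse_rtrancl_into_rtrancl)
  next
    case False
    with less.prems show ?thesis by (auto simp: normal_words_def)
  qed
qed

text \<open>Both words reduce to normal forms with the same value, and by \<open>inj\<close> these
  coincide. This yields confluence, and it is also what turns equality of values into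
  congruence.\<close>

lemma joinable:
  assumes "u \<in> words A" "v \<in> words A" "word_prod \<psi> u = word_prod \<psi> v"
  shows "\<exists>x\<in>words A. (u, x) \<in> (rstep A R)\<^sup>* \<and> (v, x) \<in> (rstep A R)\<^sup>*"
proof -
  obtain x y where x: "x \<in> normal_words A R" "(u, x) \<in> (rstep A R)\<^sup>*"
    and y: "y \<in> normal_words A R" "(v, y) \<in> (rstep A R)\<^sup>*"
    using ex_normal assms by meson
  have "x = y"
    using inj_onD[OF inj _ x(1) y(1)] sound_steps[OF x(2)] sound_steps[OF y(2)] assms(3) by simp
  with x y show ?thesis by (auto simp: normal_words_def)
qed

text \<open>Steps in either direction preserve values by soundness; conversely, words with equal
  values are linked through a common reduct. So the congruence classes are the fibres of
  \<open>word_prod \<psi>\<close>.\<close>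

lemma rcong_eq:
  "rcong A R = {(u, v). u \<in> words A \<and> v \<in> words A \<and> word_prod \<psi> u = word_prod \<psi> v}"
proof (intro subset_antisym subrelI)
  fix u v assume uv: "(u, v) \<in> rcong A R"
  then have "(u, v) \<in> (rstep A R \<union> (rstep A R)\<inverse>)\<^sup>*"
    unfolding rcong_def by auto
  then have "word_prod \<psi> u = word_prod \<psi> v"
    by (induction rule: rtrancl_induct) (auto dest: sound_step)
  with uv show "(u, v) \<in> {(u, v). u \<in> words A \<and> v \<in> words A \<and> word_prod \<psi> u = word_prod \<psi> v}"
    unfolding rcong_def by auto
next
  let ?S = "rstep A R \<union> (rstep A R)\<inverse>"
  fix u v assume uv: "(u, v) \<in> {(u, v). u \<in> words A \<and> v \<in> words A \<and> word_prod \<psi> u = word_prod \<psi> v}"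
  then obtain x where "(u, x) \<in> (rstep A R)\<^sup>*" "(v, x) \<in> (rstep A R)\<^sup>*"
    using joinable by blast
  then have "(u, x) \<in> ?S\<^sup>*" "(x, v) \<in> ?S\<^sup>*"
    by (meson in_rtrancl_UnI) (meson \<open>(v, x) \<in> (rstep A R)\<^sup>*\<close> in_rtrancl_UnI rtrancl_converseI)
  with uv show "(u, v) \<in> rcong A R"
    unfolding rcong_def by (auto intro: rtrancl_trans)
qed

lemma presented: "presented_by T A R"
proof -
  define cl where "cl t = {w \<in> words A. word_prod \<psi> w = t}" for t
  have quot: "words A // rcong A R = cl ` T"
  proof -
    have "rcong A R `` {w} = cl (word_prod \<psi> w)" if "w \<in> words A" for w
      using that by (auto simp: rcong_eq cl_def)
    then show ?thesis
      unfolding quotient_def surj[symmetric] by auto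
  qed
  have ex: "\<exists>w\<in>words A. word_prod \<psi> w = t" if "t \<in> T" for t
    using that surj by auto
  \<comment> \<open>Classes are fibres of evaluation, so every choice of representative gives the
    same value; the inverse map is \<open>cl\<close>.\<close>
  define \<phi> where "\<phi> X = word_prod \<psi> (SOME w. w \<in> X)" for X
  have \<phi>: "\<phi> (cl t) = t" if "t \<in> T" for t
  proof -
    have "\<exists>w. w \<in> cl t" using ex[OF that] by (auto simp: cl_def)
    from someI_ex[OF this] show ?thesis by (auto simp: \<phi>_def cl_def)
  qed
  have closed: "s * t \<in> T" if st: "s \<in> T" "t \<in> T" for s t
  proof -
    obtain u v where "u \<in> words A" "v \<in> words A" "word_prod \<psi> u = s" "word_prod \<psi> v = t"
      using ex[OF st(1)] ex[OF st(2)] by blast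
    then have "u @ v \<in> words A" "word_prod \<psi> (u @ v) = s * t"
      by (auto simp: in_words_iff word_prod_append)
    with surj show ?thesis by (metis imageI)
  qed
  have mult: "class_mult A R (cl s) (cl t) = cl (s * t)" if st: "s \<in> T" "t \<in> T" for s t
  proof -
    have "rcong A R `` {x @ y} = cl (s * t)" if "x \<in> cl s" "y \<in> cl t" for x y
      using that by (auto simp: rcong_eq cl_def in_words_iff word_prod_append)
    moreover have "cl s \<noteq> {}" "cl t \<noteq> {}"
      using ex st by (auto simp: cl_def)
    ultimately show ?thesis unfolding class_mult_def by auto
  qed
  have "bij_betw \<phi> (words A // rcong A R) T"
    unfolding quot by (rule bij_betw_byWitness[where f' = cl]) (auto simp: \<phi>)
  then show ?thesis
    unfolding presented_by_def quot by (auto simp: \<phi> mult closed)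
qed

lemma complete: "complete_rs A R"
  unfolding complete_rs_def
proof
  show "noetherian A R"
    using wf_step unfolding noetherian_def wf_iff_no_infinite_down_chain by auto
  show "confluent A R"
    unfolding confluent_def using joinable sound_steps by metis
qed

end

section \<open>Complete presentations versus finite complete rewriting systems\<close>

lemma complete_presentation_rename:
  assumes "complete_presentation T A R \<psi>" and f: "inj_on f A"
  shows "complete_presentation T (f ` A) (map_prod (map f) (map f) ` R) (\<psi> \<circ> inv_into A f)"
proof -
  interpret complete_presentation T A R \<psi> by fact
  define g where "g = inv_into A f"
  have gf: "map g (map f w) = w" if "set w \<subseteq> A" for w
    using that by (auto simp: g_def f subset_iff intro!: map_idI)
  have fg: "map f (map g w) = w" if "set w \<subseteq> f ` A" for w
    using that by (auto simp: g_def f subset_iff f_inv_into_f intro!: map_idI)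
  have gA: "set (map g w) \<subseteq> A" if "set w \<subseteq> f ` A" for w
    using that by (auto simp: g_def subset_iff inv_into_into)
  have RA: "X \<in> words A" "Y \<in> words A" if "(X, Y) \<in> R" for X Y
    using that rules by (auto simp: rewriting_system_def)
  let ?R = "map_prod (map f) (map f) ` R"
  have step: "(map g u, map g v) \<in> rstep A R" if uv: "(u, v) \<in> rstep (f ` A) ?R" for u v
  proof -
    obtain p q X Y where *: "u = p @ map f X @ q" "v = p @ map f Y @ q" "(X, Y) \<in> R"
      "set p \<subseteq> f ` A" "set q \<subseteq> f ` A"
      using uv by (auto elim!: rstepE)
    with rstepI[of X Y R "map g p" A "map g q"] gA RA[OF *(3)] gf[of X] gf[of Y] show ?thesis
      by (simp add: in_words_iff)
  qed
  have step': "(map f u, map f v) \<in> rstep (f ` A) ?R" if uv: "(u, v) \<in> rstep A R" for u v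
  proof -
    obtain p q X Y where *: "u = p @ X @ q" "v = p @ Y @ q" "(X, Y) \<in> R"
      "set p \<subseteq> A" "set q \<subseteq> A"
      using uv by (auto elim!: rstepE)
    then have "(map f X, map f Y) \<in> ?R" by force
    from rstepI[OF this, of "map f p" "f ` A" "map f q"] * show ?thesis
      by (simp add: image_mono)
  qed
  have prod: "word_prod (\<psi> \<circ> g) w = word_prod \<psi> (map g w)" if "w \<noteq> []" for w
    using that by (simp add: word_prod_map)
  have wordsf: "map f w \<in> words (f ` A)" if "w \<in> words A" for w
    using that by (auto simp: in_words_iff)
  have wordsg: "map g w \<in> words A" if "w \<in> words (f ` A)" for w
    using that gA by (auto simp: in_words_iff)
  show ?thesis
    unfolding g_def[symmetric]
  proof
    show "finite (f ` A)" "finite ?R"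
      using finite_letters finite_rules by auto
    show "rewriting_system (f ` A) ?R"
      using RA wordsf unfolding rewriting_system_def by auto
    show "wf ((rstep (f ` A) ?R)\<inverse>)"
      by (rule wf_subset[OF wf_inv_image[OF wf_step, of "map g"]]) (auto dest: step)
    show "word_prod (\<psi> \<circ> g) X = word_prod (\<psi> \<circ> g) Y" if XY: "(X, Y) \<in> ?R" for X Y
    proof -
      obtain X' Y' where *: "X = map f X'" "Y = map f Y'" "(X', Y') \<in> R"
        using XY by (elim prod_fun_imageE) auto
      with RA[OF *(3)] gf[of X'] gf[of Y'] sound_rule[OF *(3)] show ?thesis
        by (simp add: prod in_words_iff)
    qed
    show "word_prod (\<psi> \<circ> g) ` words (f ` A) = T"
    proof
      show "word_prod (\<psi> \<circ> g) ` words (f ` A) \<subseteq> T"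
        using wordsg surj by (auto simp: prod in_words_iff)
      show "T \<subseteq> word_prod (\<psi> \<circ> g) ` words (f ` A)"
      proof
        fix t assume "t \<in> T"
        then obtain w where w: "w \<in> words A" "word_prod \<psi> w = t" using surj by auto
        then have "word_prod (\<psi> \<circ> g) (map f w) = t"
          using gf[of w] by (simp add: prod in_words_iff)
        with wordsf[OF w(1)] show "t \<in> word_prod (\<psi> \<circ> g) ` words (f ` A)" by blast
      qed
    qed
    show "inj_on (word_prod (\<psi> \<circ> g)) (normal_words (f ` A) ?R)"
    proof (rule inj_onI)
      fix u v assume u: "u \<in> normal_words (f ` A) ?R" and v: "v \<in> normal_words (f ` A) ?R"
        and eq: "word_prod (\<psi> \<circ> g) u = word_prod (\<psi> \<circ> g) v"
      have n: "map g w \<in> normal_words A R" if "w \<in> normal_words (f ` A) ?R" for w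
        using that fg[of w] wordsg[of w]
        unfolding normal_words_def by (auto simp: in_words_iff dest!: step'[of "map g w"])
      have "map g u = map g v"
        using eq u v by (intro inj_onD[OF inj _ n[OF u] n[OF v]])
          (auto simp: prod normal_words_def in_words_iff)
      then have "map f (map g u) = map f (map g v)" by simp
      with fg[of u] fg[of v] u v show "u = v"
        by (auto simp: normal_words_def in_words_iff)
    qed
  qed
qed

text \<open>The constructions below use elements of sum types and lists as letters, while
  \<open>has_finite_complete_rs\<close> asks for natural numbers; a finite alphabet embeds into
  them.\<close>

lemma has_finite_complete_rsI:
  assumes "complete_presentation T A R \<psi>" "T \<noteq> {}"
  shows "has_finite_complete_rs T"
proof -
  have "finite A" using assms by (simp add: complete_presentation_def)
  then obtain f :: "_ \<Rightarrow> nat" where "inj_on f A"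
    using finite_imp_inj_to_nat_seg by metis
  then interpret complete_presentation T "f ` A" "map_prod (map f) (map f) ` R" "\<psi> \<circ> inv_into A f"
    using assms complete_presentation_rename by blast
  have "f ` A \<noteq> {}" using surj assms(2) by (auto simp: words_def)
  then show ?thesis
    unfolding has_finite_complete_rs_def
    using finite_letters finite_rules rules presented complete by (intro exI conjI)
qed

lemma church_rosser:
  assumes "confluent A R" and rules: "rewriting_system A R"
    and "(u, v) \<in> (rstep A R \<union> (rstep A R)\<inverse>)\<^sup>*" "u \<in> words A"
  shows "\<exists>x. (u, x) \<in> (rstep A R)\<^sup>* \<and> (v, x) \<in> (rstep A R)\<^sup>*"
  using assms(3)
proof (induction rule: rtrancl_induct)
  case (step y z)
  then obtain x where x: "(u, x) \<in> (rstep A R)\<^sup>*" "(y, x) \<in> (rstep A R)\<^sup>*" by auto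
  consider "(z, y) \<in> rstep A R" | "(y, z) \<in> rstep A R" using step.hyps by auto
  then show ?case
  proof cases
    case 1
    with x show ?thesis by (meson converse_rtrancl_into_rtrancl)
  next
    \<comment> \<open>The only case that needs confluence: it closes the peak formed by
      \<open>y\<close> reducing to \<open>x\<close> and to \<open>z\<close>. Since
      \<open>confluent\<close> speaks of \<open>words A\<close> only, the memberships have to be
      supplied.\<close>
    case 2
    then have "y \<in> words A" "z \<in> words A" using rstep_words[OF rules] by auto
    moreover from this x have "x \<in> words A" using rsteps_words[OF _ rules] by blast
    moreover have "(y, z) \<in> (rstep A R)\<^sup>*" using 2 by auto
    ultimately obtain x' where "(x, x') \<in> (rstep A R)\<^sup>*" "(z, x') \<in> (rstep A R)\<^sup>*"
      using assms(1) x unfolding confluent_def by blast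
    with x show ?thesis by (meson rtrancl_trans)
  qed
qed auto

lemma has_finite_complete_rsE:
  assumes "has_finite_complete_rs T"
  obtains A :: "nat set" and R \<psi> where "complete_presentation T A R \<psi>"
proof -
  obtain A :: "nat set" and R where fin: "finite A" "finite R" and rules: "rewriting_system A R"
    and pres: "presented_by T A R" and compl: "complete_rs A R"
    using assms unfolding has_finite_complete_rs_def by auto
  obtain \<phi> where bij: "bij_betw \<phi> (words A // rcong A R) T"
    and hom: "\<And>X Y. X \<in> words A // rcong A R \<Longrightarrow> Y \<in> words A // rcong A R \<Longrightarrow>
       \<phi> (class_mult A R X Y) = \<phi> X * \<phi> Y"
    using pres unfolding presented_by_def by blast
  let ?S = "rstep A R \<union> (rstep A R)\<inverse>"
  have eqv: "equiv (words A) (rcong A R)"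
  proof (rule equivI)
    have "sym ?S" by (auto simp: sym_def)
    from sym_rtrancl[OF this] show "sym (rcong A R)"
      unfolding rcong_def by (auto simp: sym_def)
    show "trans (rcong A R)"
      unfolding rcong_def trans_def by (auto intro: rtrancl_trans)
  qed (auto simp: rcong_def refl_on_def)
  define cl where "cl w = rcong A R `` {w}" for w
  have cl_quot: "cl w \<in> words A // rcong A R" if "w \<in> words A" for w
    using that by (auto simp: cl_def quotientI)
  have cl_eq: "cl u = cl v \<longleftrightarrow> (u, v) \<in> rcong A R" if "u \<in> words A" "v \<in> words A" for u v
    using eq_equiv_class_iff[OF eqv] that by (simp add: cl_def)
  have ctx: "(p @ x @ q, p @ y @ q) \<in> ?S\<^sup>*"
    if "(x, y) \<in> ?S\<^sup>*" "set p \<subseteq> A" "set q \<subseteq> A" for p x y q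
    using that(1)
  proof (induction rule: rtrancl_induct)
    case (step y z)
    then have "(p @ y @ q, p @ z @ q) \<in> ?S"
      using rstep_context that(2,3) by blast
    with step.IH show ?case by (rule rtrancl_into_rtrancl)
  qed simp
  have cl_mult: "class_mult A R (cl u) (cl v) = cl (u @ v)" if uv: "u \<in> words A" "v \<in> words A" for u v
  proof -
    have "rcong A R `` {x @ y} = cl (u @ v)" if "x \<in> cl u" "y \<in> cl v" for x y
    proof -
      have xy: "x \<in> words A" "y \<in> words A" "(u, x) \<in> ?S\<^sup>*" "(v, y) \<in> ?S\<^sup>*"
        using that by (auto simp: cl_def rcong_def)
      then have "(u @ v, x @ v) \<in> ?S\<^sup>*" "(x @ v, x @ y) \<in> ?S\<^sup>*"
        using ctx[of u x "[]" v] ctx[of v y x "[]"] uv by (auto simp: in_words_iff)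
      then have "(u @ v, x @ y) \<in> rcong A R"
        unfolding rcong_def using uv xy by (auto simp: in_words_iff intro: rtrancl_trans)
      then show ?thesis
        using equiv_class_eq[OF eqv] by (auto simp: cl_def)
    qed
    moreover have "u \<in> cl u" "v \<in> cl v"
      using uv by (auto simp: cl_def rcong_def)
    ultimately show ?thesis unfolding class_mult_def by blast
  qed
  \<comment> \<open>By multiplicativity the isomorphism is determined by its values on the classes
    of one-letter words.\<close>
  define \<psi> where "\<psi> a = \<phi> (cl [a])" for a
  have prod: "word_prod \<psi> w = \<phi> (cl w)" if "w \<in> words A" for w
    using that
  proof (induction w rule: induct_list012)
    case (3 a b w)
    then have w: "[a] \<in> words A" "b # w \<in> words A" by (auto simp: in_words_iff)
    with 3 have "word_prod \<psi> (a # b # w) = \<phi> (cl [a]) * \<phi> (cl (b # w))"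
      by (simp add: \<psi>_def[of a])
    also have "\<dots> = \<phi> (class_mult A R (cl [a]) (cl (b # w)))"
      using hom cl_quot w by simp
    finally show ?case using cl_mult[OF w] by simp
  qed (auto simp: in_words_iff \<psi>_def)
  have prod_eq: "word_prod \<psi> u = word_prod \<psi> v \<longleftrightarrow> (u, v) \<in> rcong A R"
    if "u \<in> words A" "v \<in> words A" for u v
    using that inj_on_eq_iff[OF bij_betw_imp_inj_on[OF bij] cl_quot cl_quot] cl_eq
    by (simp add: prod)
  have "complete_presentation T A R \<psi>"
  proof
    show "wf ((rstep A R)\<inverse>)"
      using compl unfolding complete_rs_def noetherian_def wf_iff_no_infinite_down_chain by auto
    show "word_prod \<psi> X = word_prod \<psi> Y" if "(X, Y) \<in> R" for X Y
    proof -
      have "X \<in> words A" "Y \<in> words A"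
        using that rules by (auto simp: rewriting_system_def)
      moreover have "(X, Y) \<in> ?S\<^sup>*"
        using rstepI[OF that, of "[]" A "[]"] by auto
      ultimately show ?thesis by (simp add: prod_eq rcong_def)
    qed
    have "word_prod \<psi> ` words A = \<phi> ` cl ` words A"
      by (auto simp: prod image_image)
    also have "cl ` words A = words A // rcong A R"
      by (auto simp: cl_def quotient_def)
    finally show "word_prod \<psi> ` words A = T"
      using bij by (simp add: bij_betw_def)
    show "inj_on (word_prod \<psi>) (normal_words A R)"
    proof (rule inj_onI)
      fix u v assume u: "u \<in> normal_words A R" and v: "v \<in> normal_words A R"
        and eq: "word_prod \<psi> u = word_prod \<psi> v"
      then have uv: "u \<in> words A" "v \<in> words A" by (auto simp: normal_words_def)
      with eq have "(u, v) \<in> ?S\<^sup>*" by (simp add: prod_eq rcong_def)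
      then obtain x where "(u, x) \<in> (rstep A R)\<^sup>*" "(v, x) \<in> (rstep A R)\<^sup>*"
        using church_rosser[OF _ rules _ uv(1)] compl unfolding complete_rs_def by blast
      \<comment> \<open>An irreducible word is its own only reduct, so both words equal the common
        reduct \<open>x\<close>.\<close>
      with u v show "u = v"
        unfolding normal_words_def by (metis Diff_iff Domain.DomainI converse_rtranclE)
    qed
  qed (use fin rules in auto)
  with that show ?thesis .
qed

section \<open>Small extensions\<close>

text \<open>Empty segments are kept, so that the number of segments counts the letters \<open>Inr x\<close>.\<close>

fun segments :: "('b + 'c) list \<Rightarrow> 'b list list" where
  "segments [] = [[]]"
| "segments (Inl a # w) = (a # hd (segments w)) # tl (segments w)"
| "segments (Inr x # w) = [] # segments w"

lemma segments_nonempty: "segments w \<noteq> []"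
  by (induction w rule: segments.induct) auto

text \<open>No new letter stands at the junction, so the segments that meet there merge into
  one.\<close>

lemma segments_append:
  "segments (u @ v) = butlast (segments u) @ (last (segments u) @ hd (segments v)) # tl (segments v)"
proof (induction u rule: segments.induct)
  case (2 a u)
  obtain s ss where "segments u = s # ss" using segments_nonempty[of u] by (cases "segments u") auto
  with 2 show ?case by (cases ss) auto
qed (auto simp: segments_nonempty)

lemma segments_Inl: "segments (map Inl w) = [w]"
  by (induction w) auto

lemma segments_set: "s \<in> set (segments w) \<Longrightarrow> set s \<subseteq> Inl -` set w"
proof (induction w arbitrary: s rule: segments.induct)
  case (2 a w)
  then show ?case using segments_nonempty[of w] by (cases "segments w") fastforce+
qed auto

section \<open>Termination when letters may also be dropped at the ends\<close>

lemma listrel1_middle: "(x, y) \<in> r \<Longrightarrow> (p @ x # q, p @ y # q) \<in> listrel1 r"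
  by (auto simp: listrel1_def)

text \<open>This is what happens to a segment when the new letter next to it absorbs its first or
  last letter.\<close>

definition trim :: "'b set \<Rightarrow> ('b list \<times> 'b list) set" where
  "trim A = {(w, v) | w v a. set w \<subseteq> A \<and> (w = a # v \<or> w = v @ [a])}"

text \<open>Lengths may grow under rewriting, so follow a factor \<open>v\<close> of an ambient word
  \<open>u\<close>. A rewriting step on \<open>v\<close> is a step on \<open>u\<close>; trimming
  shortens \<open>v\<close> and moves the lost letter into the context, leaving \<open>u\<close>
  unchanged. Induct on \<open>u\<close> along rewriting, then on the length of
  \<open>v\<close>.\<close>

lemma wf_step_trim:
  assumes wf: "wf ((rstep A R)\<inverse>)" and rules: "rewriting_system A R"
  shows "wf ((rstep A R \<union> trim A)\<inverse>)"
proof -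
  let ?G = "(rstep A R \<union> trim A)\<inverse>"
  have acc: "v \<in> Wellfounded.acc ?G" if "set u \<subseteq> A" "u = p @ v @ q" for u p v q
    using wf that
  proof (induction u arbitrary: p v q rule: wf_induct_rule)
    case (less u)
    from less.prems show ?case
    proof (induction v arbitrary: p q rule: length_induct)
      case (1 v)
      show ?case
      proof (rule accI)
        fix v' assume "(v', v) \<in> ?G"
        then consider "(v, v') \<in> rstep A R" | a where "v = a # v'" | a where "v = v' @ [a]"
          unfolding trim_def by auto
        then show "v' \<in> Wellfounded.acc ?G"
        proof cases
          case 1
          then have step: "(u, p @ v' @ q) \<in> rstep A R"
            using rstep_context[of v v' A R p q] "1.prems" by auto
          then have "set (p @ v' @ q) \<subseteq> A"
            using rstep_words[OF rules step] by (simp add: in_words_iff)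
          with less.IH step show ?thesis by blast
        next
          case 2
          with "1.prems" have "u = (p @ [a]) @ v' @ q" by simp
          with "1.IH" "1.prems"(1) 2 show ?thesis by (metis length_Cons lessI)
        next
          case 3
          with "1.prems" have "u = p @ v' @ (a # q)" by simp
          with "1.IH" "1.prems"(1) 3 show ?thesis by (metis length_append_singleton lessI)
        qed
      qed
    qed
  qed
  show ?thesis
  proof (rule acc_wfI, rule allI)
    fix v
    show "v \<in> Wellfounded.acc ?G"
    proof (cases "set v \<subseteq> A")
      case True
      then show ?thesis using acc[of v "[]" v "[]"] by simp
    next
      \<comment> \<open>A word with a letter outside \<open>A\<close> has no successor in either
        relation, so it is accessible trivially.\<close>
      case False
      show ?thesis
      proof (rule accI)
        fix v' assume "(v', v) \<in> ?G"
        then have "(v, v') \<in> rstep A R \<or> (v, v') \<in> trim A" by simp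
        then have "set v \<subseteq> A"
          using rstep_words[OF rules, of v v'] by (auto simp: trim_def in_words_iff)
        with False show "v' \<in> Wellfounded.acc ?G" ..
      qed
    qed
  qed
qed

section \<open>The rewriting system of a small extension\<close>

locale small_extension = complete_presentation T A R \<psi>
  for T :: "'a::semigroup_mult set" and A :: "'b set" and R and \<psi> +
  assumes fin: "finite (UNIV - T)"
begin

definition B :: "('b + 'a) set" where
  "B = A <+> (UNIV - T)"

abbreviation val :: "'b + 'a \<Rightarrow> 'a" where
  "val \<equiv> case_sum \<psi> (\<lambda>x. x)"

definition rep :: "'a \<Rightarrow> ('b + 'a) list" where
  "rep s = (if s \<in> T then map Inl (SOME w. w \<in> words A \<and> word_prod \<psi> w = s) else [Inr s])"

lemma rep_T:
  assumes "s \<in> T"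
  obtains w where "w \<in> words A" "word_prod \<psi> w = s" "rep s = map Inl w"
proof -
  have "\<exists>w. w \<in> words A \<and> word_prod \<psi> w = s" using assms surj by auto
  note w = someI_ex[OF this]
  show ?thesis
    using that[OF conjunct1[OF w] conjunct2[OF w]] assms by (simp add: rep_def)
qed

lemma word_prod_Inl: "w \<noteq> [] \<Longrightarrow> word_prod val (map Inl w) = word_prod \<psi> w"
  by (simp add: word_prod_map comp_def)

lemma map_Inl_words: "map Inl w \<in> words B \<longleftrightarrow> w \<in> words A"
  by (auto simp: in_words_iff B_def)

lemma rep: "rep s \<in> words B" "word_prod val (rep s) = s"
proof -
  have "rep s \<in> words B \<and> word_prod val (rep s) = s"
  proof (cases "s \<in> T")
    case True
    then obtain w where "w \<in> words A" "word_prod \<psi> w = s" "rep s = map Inl w" by (rule rep_T)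
    then show ?thesis by (simp add: map_Inl_words) (simp add: word_prod_Inl in_words_iff)
  qed (auto simp: rep_def in_words_iff B_def)
  then show "rep s \<in> words B" "word_prod val (rep s) = s" by auto
qed

definition pairs :: "(('b + 'a) \<times> ('b + 'a)) set" where
  "pairs = {(x, y) \<in> B \<times> B. \<not> (isl x \<and> isl y)}"

definition ext_rules :: "(('b + 'a) list \<times> ('b + 'a) list) set" where
  "ext_rules = map_prod (map Inl) (map Inl) ` R \<union> (\<lambda>(x, y). ([x, y], rep (val x * val y))) ` pairs"

lemma ext_rulesE:
  assumes "(X, Y) \<in> ext_rules"
  obtains (old) X' Y' where "X = map Inl X'" "Y = map Inl Y'" "(X', Y') \<in> R"
  | (new) x y where "X = [x, y]" "Y = rep (val x * val y)" "x \<in> B" "y \<in> B" "\<not> (isl x \<and> isl y)"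
  using assms unfolding ext_rules_def pairs_def by auto

lemma length_segments_rep: "length (segments (rep s)) = (if s \<in> T then 1 else 2)"
  by (auto simp: rep_def segments_Inl)

text \<open>The number of segments is one more than the number of new letters. An old rule rewrites
  inside one segment. A new rule lowers the number of new letters if the product lies in
  \<open>T\<close> or both letters are new. Otherwise a new letter absorbs a letter of
  \<open>A\<close> and possibly changes its name, which \<open>segments\<close> ignores; the segment
  on that side is trimmed.\<close>

lemma ext_step_decreases:
  assumes "(u, v) \<in> rstep B ext_rules"
  shows "length (segments v) < length (segments u) \<or>
    length (segments v) = length (segments u) \<and>
      (segments v, segments u) \<in> listrel1 ((rstep A R \<union> trim A)\<inverse>)"
proof -
  obtain p q X Y where uv: "u = p @ X @ q" "v = p @ Y @ q" and r: "(X, Y) \<in> ext_rules"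
    and pq: "set p \<subseteq> B" "set q \<subseteq> B"
    using assms by (rule rstepE)
  define p' s where "p' = butlast (segments p)" and "s = last (segments p)"
  define q' t where "q' = tl (segments q)" and "t = hd (segments q)"
  have p: "segments (p @ w) = p' @ (s @ hd (segments w)) # tl (segments w)" for w
    by (simp add: segments_append p'_def s_def)
  have q: "segments q = t # q'" using segments_nonempty[of q] by (simp add: q'_def t_def)
  have seg_A: "set w \<subseteq> A" if "w \<in> set (segments z)" "set z \<subseteq> B" for w z
    using segments_set[OF that(1)] that(2) by (auto simp: B_def)
  have s: "set s \<subseteq> A"
    unfolding s_def by (rule seg_A[OF last_in_set[OF segments_nonempty] pq(1)])
  have t: "set t \<subseteq> A"
    by (rule seg_A[of _ q]) (auto simp: q pq(2))
  from r show ?thesis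
  proof (cases rule: ext_rulesE)
    case (old X' Y')
    have Inl: "segments (p @ map Inl w @ q) = p' @ (s @ w @ t) # q'" for w
      unfolding p by (simp add: segments_append segments_Inl q)
    have "(s @ Y' @ t, s @ X' @ t) \<in> (rstep A R \<union> trim A)\<inverse>"
      using rstepI[OF old(3) s t] by simp
    from listrel1_middle[OF this] show ?thesis by (simp add: uv old Inl)
  next
    case (new x y)
    \<comment> \<open>Counts add up except for the merged segment, so a comparison of
      \<open>Y\<close> with \<open>X\<close> carries over to \<open>v\<close> and
      \<open>u\<close>.\<close>
    have len: "length (segments (w @ z)) + 1 = length (segments w) + length (segments z)"
      for w z :: "('b + 'a) list"
      using segments_nonempty[of w] segments_nonempty[of z]
      by (simp add: segments_append neq_Nil_conv)
    consider (drop) "val x * val y \<in> T" | (FF) "\<not> isl x" "\<not> isl y"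
      | (AF) a f where "x = Inl a" "y = Inr f" "val x * val y \<notin> T"
      | (FA) f a where "x = Inr f" "y = Inl a" "val x * val y \<notin> T"
      using new(5) by (cases x; cases y) auto
    then show ?thesis
    proof cases
      case drop
      then have "length (segments Y) < length (segments X)"
        using new by (cases x; cases y) (auto simp: length_segments_rep)
      with len[of p "X @ q"] len[of X q] len[of p "Y @ q"] len[of Y q] show ?thesis
        unfolding uv by linarith
    next
      case FF
      then have "length (segments Y) < length (segments X)"
        using new by (cases x; cases y) (auto simp: length_segments_rep)
      with len[of p "X @ q"] len[of X q] len[of p "Y @ q"] len[of Y q] show ?thesis
        unfolding uv by linarith
    next
      case AF
      then have "a \<in> A" using new by (auto simp: B_def)
      then have "(s, s @ [a]) \<in> (rstep A R \<union> trim A)\<inverse>"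
        using s by (auto simp: trim_def)
      from listrel1_middle[OF this, of p' "segments q"] AF show ?thesis
        by (simp add: uv new p rep_def)
    next
      case FA
      then have "a \<in> A" using new by (auto simp: B_def)
      then have "(t, a # t) \<in> (rstep A R \<union> trim A)\<inverse>"
        using t by (auto simp: trim_def)
      from listrel1_middle[OF this, of "p' @ [s]" q'] FA show ?thesis
        by (simp add: uv new p rep_def q)
    qed
  qed
qed

lemma wf_ext_step: "wf ((rstep B ext_rules)\<inverse>)"
proof (rule wf_subset)
  let ?r = "inv_image (less_than <*lex*> listrel1 ((rstep A R \<union> trim A)\<inverse>))
    (\<lambda>u. (length (segments u), segments u))"
  show "wf ?r"
    using wf_step_trim[OF wf_step rules] by (intro wf_inv_image wf_lex_prod) auto
  show "(rstep B ext_rules)\<inverse> \<subseteq> ?r"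
    using ext_step_decreases by fastforce
qed

text \<open>A new letter together with any neighbour is the left side of a rule, so in an
  irreducible word it stands alone.\<close>

lemma ext_normal:
  assumes w: "w \<in> normal_words B ext_rules"
  obtains (F) x where "w = [Inr x]" "x \<notin> T" | (A) v where "w = map Inl v" "v \<in> normal_words A R"
proof (cases "\<exists>x. Inr x \<in> set w")
  case True
  have B: "set w \<subseteq> B" and irr: "w \<notin> Domain (rstep B ext_rules)"
    using w by (auto simp: normal_words_def in_words_iff)
  have no_pair: False if "w = p @ [x, y] @ q" "\<not> (isl x \<and> isl y)" for p x y q
  proof -
    have "([x, y], rep (val x * val y)) \<in> ext_rules"
      using that B by (force simp: ext_rules_def pairs_def)
    from rstepI[OF this, of p B q] that(1) B irr show False by auto
  qed
  obtain p x q where pq: "w = p @ Inr x # q" using True by (meson split_list)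
  have "q = []"
  proof (cases q)
    case (Cons y q')
    then show ?thesis using no_pair[of p "Inr x" y q'] pq by simp
  qed simp
  moreover have "p = []"
  proof (cases p rule: rev_cases)
    case (snoc p' y)
    then show ?thesis using no_pair[of p' y "Inr x" q] pq by simp
  qed simp
  ultimately have "w = [Inr x]" using pq by simp
  with B F show ?thesis by (auto simp: B_def)
next
  case False
  then have "\<forall>x\<in>set w. \<exists>a. x = Inl a" by (metis sum.exhaust)
  then obtain v where v: "w = map Inl v" by (metis ex_map_conv)
  have "v \<in> words A" using w by (simp add: v normal_words_def map_Inl_words)
  moreover have "v \<notin> Domain (rstep A R)"
  proof
    assume "v \<in> Domain (rstep A R)"
    then obtain p q X Y where *: "v = p @ X @ q" "(X, Y) \<in> R" "set p \<subseteq> A" "set q \<subseteq> A"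
      by (auto elim: rstepE)
    then have "(map Inl X, map Inl Y) \<in> ext_rules" by (force simp: ext_rules_def)
    from rstepI[OF this, of "map Inl p" B "map Inl q"] * have "w \<in> Domain (rstep B ext_rules)"
      by (auto simp: v B_def)
    with w show False by (simp add: normal_words_def)
  qed
  ultimately show ?thesis using A v by (simp add: normal_words_def)
qed

lemma ext_presentation: "complete_presentation UNIV B ext_rules val"
proof
  show "finite B" using finite_letters fin by (simp add: B_def)
  then have "finite pairs" unfolding pairs_def by (auto intro: finite_subset[of _ "B \<times> B"])
  then show "finite ext_rules" using finite_rules by (simp add: ext_rules_def)
  show "rewriting_system B ext_rules"
    unfolding rewriting_system_def
  proof (rule subrelI)
    fix X Y assume "(X, Y) \<in> ext_rules"
    then show "(X, Y) \<in> words B \<times> words B"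
    proof (cases rule: ext_rulesE)
      case (old X' Y')
      with rules show ?thesis by (auto simp: rewriting_system_def map_Inl_words)
    next
      case (new x y)
      then show ?thesis using rep(1) by (simp add: in_words_iff)
    qed
  qed
  show "wf ((rstep B ext_rules)\<inverse>)" by (rule wf_ext_step)
  show "word_prod val X = word_prod val Y" if "(X, Y) \<in> ext_rules" for X Y
    using that
  proof (cases rule: ext_rulesE)
    case (old X' Y')
    then have "X' \<noteq> []" "Y' \<noteq> []" using rules by (auto simp: rewriting_system_def in_words_iff)
    with old sound_rule[OF old(3)] show ?thesis by (simp add: word_prod_Inl)
  next
    case (new x y)
    then show ?thesis by (simp add: rep)
  qed
  show "word_prod val ` words B = UNIV"
    using rep by (metis UNIV_eq_I imageI)
  have T: "word_prod \<psi> v \<in> T" if "v \<in> normal_words A R" for v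
    using that surj by (auto simp: normal_words_def)
  have prod: "word_prod val (map Inl v) = word_prod \<psi> v" if "v \<in> normal_words A R" for v
    using that by (intro word_prod_Inl) (auto simp: normal_words_def in_words_iff)
  \<comment> \<open>The two kinds of irreducible words cannot share a value: new letters have values
    outside \<open>T\<close>, old irreducible words have values in \<open>T\<close>.\<close>
  show "inj_on (word_prod val) (normal_words B ext_rules)"
  proof (rule inj_onI)
    fix u v assume u: "u \<in> normal_words B ext_rules" and v: "v \<in> normal_words B ext_rules"
      and eq: "word_prod val u = word_prod val v"
    from u show "u = v"
    proof (cases rule: ext_normal)
      case u: (F x)
      from v show ?thesis
        by (cases rule: ext_normal) (use u eq T prod in auto)
    next
      case u: (A u')
      from v show ?thesis
      proof (cases rule: ext_normal)
        case (F x)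
        with u eq T prod show ?thesis by auto
      next
        case (A v')
        with u eq prod have "word_prod \<psi> u' = word_prod \<psi> v'" by simp
        with inj_onD[OF inj _ u(2) A(2)] show ?thesis by (simp add: u A)
      qed
    qed
  qed
qed

end

lemma small_extension_has_finite_complete_rs:
  fixes T :: "'a::semigroup_mult set"
  assumes "finite (UNIV - T)" "has_finite_complete_rs T"
  shows "has_finite_complete_rs (UNIV :: 'a set)"
proof -
  obtain A :: "nat set" and R \<psi> where "complete_presentation T A R \<psi>"
    using assms(2) by (rule has_finite_complete_rsE)
  then interpret small_extension T A R \<psi>
    using assms(1) by (simp add: small_extension_def small_extension_axioms_def)
  show ?thesis using has_finite_complete_rsI[OF ext_presentation] by simp
qed

section \<open>Large subsemigroups\<close>

lemma rsteps_context:
  assumes "(u, v) \<in> (rstep A R)\<^sup>+" "set p \<subseteq> A" "set q \<subseteq> A"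
  shows "(p @ u @ q, p @ v @ q) \<in> (rstep A R)\<^sup>+"
  using assms(1)
proof (induction rule: trancl_induct)
  case (base y)
  then show ?case using rstep_context assms(2,3) by (meson r_into_trancl)
next
  case (step y z)
  then show ?case using rstep_context assms(2,3) by (meson trancl_into_trancl)
qed

lemma length_le_length_concat: "[] \<notin> set \<beta> \<Longrightarrow> length \<beta> \<le> length (concat \<beta>)"
  by (induction \<beta>) (auto simp: Suc_le_eq add_strict_increasing)

text \<open>Start the window at the block in which \<open>x\<close> begins. As blocks are nonempty,
  \<open>length x\<close> consecutive blocks reach the end of \<open>x\<close>. This bounds how many
  blocks are needed to see a redex.\<close>

lemma concat_window:
  assumes "concat \<beta> = p @ x @ q" "[] \<notin> set \<beta>" "x \<noteq> []"
  shows "\<exists>\<beta>\<^sub>1 \<gamma> \<beta>\<^sub>2 p' q'. \<beta> = \<beta>\<^sub>1 @ \<gamma> @ \<beta>\<^sub>2 \<and> length \<gamma> \<le> length x \<and> concat \<gamma> = p' @ x @ q'"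
  using assms
proof (induction \<beta> arbitrary: p)
  case (Cons b \<beta>)
  show ?case
  proof (cases "length b \<le> length p")
    case True
    with Cons.prems(1) have "concat \<beta> = drop (length b) p @ x @ q"
      by (auto simp: append_eq_append_conv2)
    with Cons.IH[of "drop (length b) p"] Cons.prems obtain \<beta>\<^sub>1 \<gamma> \<beta>\<^sub>2 p' q'
      where *: "\<beta> = \<beta>\<^sub>1 @ \<gamma> @ \<beta>\<^sub>2" "length \<gamma> \<le> length x" "concat \<gamma> = p' @ x @ q'" by auto
    have "b # \<beta> = (b # \<beta>\<^sub>1) @ \<gamma> @ \<beta>\<^sub>2" by (simp add: *(1))
    with * show ?thesis by blast
  next
    case False
    \<comment> \<open>The first block extends beyond \<open>p\<close>, so it supplies at least one
      letter of \<open>x\<close>, and each further block supplies at least one letter. If fewer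
      blocks remain, all of them are taken.\<close>
    define \<gamma> where "\<gamma> = take (length x) (b # \<beta>)"
    show ?thesis
    proof (cases "length (b # \<beta>) \<le> length x")
      case True
      have "b # \<beta> = [] @ (b # \<beta>) @ []" by simp
      with True Cons.prems(1) show ?thesis by blast
    next
      case long: False
      obtain m where m: "length x = Suc m" using Cons.prems(3) by (cases x) auto
      have \<gamma>: "\<gamma> = b # take m \<beta>" by (simp add: \<gamma>_def m)
      have "[] \<notin> set (take m \<beta>)" using Cons.prems(2) by (auto dest: in_set_takeD)
      from length_le_length_concat[OF this] have "m \<le> length (concat (take m \<beta>))"
        using long m by simp
      then have len: "length (p @ x) \<le> length (concat \<gamma>)"
        using False by (simp add: \<gamma> m)
      have "concat \<gamma> @ concat (drop (length x) (b # \<beta>)) = concat (b # \<beta>)"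
        by (metis \<gamma>_def append_take_drop_id concat_append)
      then have "take (length (p @ x)) (concat \<gamma>) = p @ x"
        using Cons.prems(1) len
        by (metis append.assoc append_eq_append_conv_if append_eq_conv_conj)
      then have "concat \<gamma> = p @ x @ drop (length (p @ x)) (concat \<gamma>)"
        by (metis append.assoc append_take_drop_id)
      moreover have "b # \<beta> = [] @ \<gamma> @ drop (length x) (b # \<beta>)"
        by (simp add: \<gamma>_def)
      moreover have "length \<gamma> \<le> length x" by (simp add: \<gamma>_def)
      ultimately show ?thesis by blast
    qed
  qed
qed auto

text \<open>The cut points of the factorisation \<open>\<beta>\<close> of \<open>concat \<beta>\<close>, as zeros. Unlike the list of
  block lengths, this list has a length that depends only on \<open>concat \<beta>\<close>, so that the
  lexicographic order is well-founded.\<close>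

definition cut_marks :: "'b list list \<Rightarrow> nat list" where
  "cut_marks \<beta> = concat (map (\<lambda>b. replicate (length b - 1) 1 @ [0]) \<beta>)"

lemma cut_marks_append: "cut_marks (\<beta> @ \<gamma>) = cut_marks \<beta> @ cut_marks \<gamma>"
  by (simp add: cut_marks_def)

lemma length_cut_marks: "[] \<notin> set \<beta> \<Longrightarrow> length (cut_marks \<beta>) = length (concat \<beta>)"
  by (induction \<beta>) (auto simp: cut_marks_def)

lemma lex_context: "(u, v) \<in> lex r \<Longrightarrow> (p @ u @ q, p @ v @ q) \<in> lex r"
  unfolding lex_conv by (auto, metis append.assoc append_Cons)

text \<open>\<open>N\<close> bounds two finite families: the irreducible words with value outside
  \<open>T\<close>, so that long factors may be cut off freely, and the left sides of rules, so that
  redexes fit into few blocks.\<close>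

locale large_subsemigroup = complete_presentation UNIV A R \<psi>
  for A :: "'b set" and R and \<psi> :: "'b \<Rightarrow> 'a::semigroup_mult" +
  fixes T :: "'a::semigroup_mult set" and N :: nat
  assumes T: "subsemigroup T"
    and long: "w \<in> normal_words A R \<Longrightarrow> N < length w \<Longrightarrow> word_prod \<psi> w \<in> T"
    and lhs: "(X, Y) \<in> R \<Longrightarrow> length X \<le> N"
begin

section \<open>The greedy factorisation into blocks\<close>

definition L :: "'b list set" where
  "L = {w \<in> normal_words A R. word_prod \<psi> w \<in> T}"

text \<open>A word of \<open>L\<close> longer than \<open>2 * N + 2\<close> splits after
  \<open>N + 1\<close> letters into two factors longer than \<open>N\<close>, both of which lie in
  \<open>L\<close> again. Hence these blocks suffice to factorise all of \<open>L\<close>.\<close>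

definition B :: "'b list set" where
  "B = {w \<in> L. length w \<le> 2 * N + 2}"

lemma Nil_notin_L: "[] \<notin> L"
  by (simp add: L_def normal_words_def words_def)

lemma Nil_notin_B: "[] \<notin> B"
  by (simp add: B_def Nil_notin_L)

lemma set_subset_BD: "set \<beta> \<subseteq> B \<Longrightarrow> [] \<notin> set \<beta>"
  using Nil_notin_B by auto

lemma long_factor_L:
  assumes "p @ w @ q \<in> normal_words A R" "N < length w"
  shows "w \<in> L"
proof -
  have "w \<noteq> []" using assms(2) by auto
  then show ?thesis
    using normal_words_factor[OF assms(1)] long assms(2) by (auto simp: L_def)
qed

lemma finite_B: "finite B"
proof (rule finite_subset)
  show "B \<subseteq> {w. set w \<subseteq> A \<and> length w \<le> 2 * N + 2}"
    by (auto simp: B_def L_def normal_words_def in_words_iff)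
qed (rule finite_lists_length_le[OF finite_letters])

lemma concat_B:
  assumes "\<beta> \<in> words B"
  shows "concat \<beta> \<in> words A" "word_prod \<psi> (concat \<beta>) \<in> T"
proof -
  from assms have "\<beta> \<noteq> []" "set \<beta> \<subseteq> B" by (auto simp: in_words_iff)
  then have "concat \<beta> \<in> words A \<and> word_prod \<psi> (concat \<beta>) \<in> T"
  proof (induction \<beta> rule: list_nonempty_induct)
    case (single b)
    then show ?case by (simp add: B_def L_def normal_words_def)
  next
    case (cons b \<beta>)
    then have "b \<in> words A" "word_prod \<psi> b \<in> T"
      by (auto simp: B_def L_def normal_words_def)
    with cons T show ?case
      by (simp add: in_words_iff word_prod_append subsemigroup_def)
  qed
  then show "concat \<beta> \<in> words A" "word_prod \<psi> (concat \<beta>) \<in> T" by auto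
qed

lemma concat_B_L: "\<beta> \<in> words B \<Longrightarrow> concat \<beta> \<in> normal_words A R \<Longrightarrow> concat \<beta> \<in> L"
  using concat_B(2) by (simp add: L_def)

text \<open>The remainder may be empty, so that a short word can be a single block; a nonempty
  remainder must itself be factorisable.\<close>

definition cut :: "'b list \<Rightarrow> nat \<Rightarrow> bool" where
  "cut w n \<longleftrightarrow> take n w \<in> B \<and> (drop n w = [] \<or> drop n w \<in> L)"

lemma ex_cut:
  assumes "w \<in> L"
  shows "\<exists>n. cut w n"
proof (cases "length w \<le> 2 * N + 2")
  case True
  with assms have "cut w (length w)" by (simp add: cut_def B_def)
  then show ?thesis ..
next
  case False
  have w: "w \<in> normal_words A R" using assms by (simp add: L_def)
  have "take (N + 1) w \<in> L"
    using w False by (intro long_factor_L[of "[]" _ "drop (N + 1) w"]) auto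
  moreover have "drop (N + 1) w \<in> L"
    using w False by (intro long_factor_L[of "take (N + 1) w" _ "[]"]) auto
  ultimately have "cut w (N + 1)" by (simp add: cut_def B_def)
  then show ?thesis ..
qed

lemma cut_Least: "w \<in> L \<Longrightarrow> cut w (LEAST n. cut w n)"
  using ex_cut by (rule LeastI_ex)

lemma cut_pos: "cut w n \<Longrightarrow> 0 < n \<and> w \<noteq> []"
  using Nil_notin_B by (auto simp: cut_def intro: Nat.gr0I)

text \<open>The empty remainder is not in \<open>L\<close>, so the default value \<open>[]\<close>
  is what ends the factorisation.\<close>

function dec :: "'b list \<Rightarrow> 'b list list" where
  "dec w = (if w \<in> L then take (LEAST n. cut w n) w # dec (drop (LEAST n. cut w n) w) else [])"
  by auto
termination
proof (relation "measure length")
  fix w assume "w \<in> L"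
  from cut_pos[OF cut_Least[OF this]]
  show "(drop (LEAST n. cut w n) w, w) \<in> measure length" by simp
qed simp

declare dec.simps [simp del]

lemma dec_words: "w \<in> L \<Longrightarrow> dec w \<in> words B"
  and concat_dec: "w \<in> L \<Longrightarrow> concat (dec w) = w"
proof -
  have "set (dec w) \<subseteq> B \<and> (w \<in> L \<longrightarrow> concat (dec w) = w)" for w
  proof (induction w rule: dec.induct)
    case (1 w)
    show ?case
    proof (cases "w \<in> L")
      case True
      define n where "n = (LEAST n. cut w n)"
      have "cut w n" using cut_Least[OF True] by (simp add: n_def)
      with 1[OF True] True show ?thesis
        unfolding dec.simps[of w] n_def[symmetric]
        by (auto simp: cut_def dec.simps[of "[]"] Nil_notin_L)
    qed (simp add: dec.simps)
  qed
  moreover have "w \<in> L \<Longrightarrow> dec w \<noteq> []" by (simp add: dec.simps)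
  ultimately show "w \<in> L \<Longrightarrow> dec w \<in> words B" "w \<in> L \<Longrightarrow> concat (dec w) = w"
    by (simp_all add: in_words_iff)
qed

text \<open>What follows the first block is empty or a product of blocks, hence has its value in
  \<open>T\<close>. So the greedy first block is never longer than the first block of another
  factorisation.\<close>

lemma dec_Cons:
  assumes "b # \<beta> \<in> words B" "concat (b # \<beta>) \<in> normal_words A R"
  shows "cut (concat (b # \<beta>)) (length b)"
proof -
  have "concat \<beta> = [] \<or> concat \<beta> \<in> L"
  proof (cases "\<beta> = []")
    case False
    with assms(1) have \<beta>: "\<beta> \<in> words B" by (simp add: in_words_iff)
    with assms(2) concat_B(1)[OF \<beta>] show ?thesis
      using concat_B_L[OF \<beta>] normal_words_factor[of b "concat \<beta>" "[]" A R]
      by (simp add: in_words_iff)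
  qed simp
  with assms(1) show ?thesis by (simp add: cut_def in_words_iff)
qed

text \<open>Compare the first blocks. If they agree, pass to the remainder. Otherwise the greedy cut
  after \<open>n\<close> letters comes earlier: up to there all marks agree, and the
  \<open>n\<close>-th mark is 0 for the greedy factorisation and 1 for
  \<open>\<beta>\<close>.\<close>

lemma dec_least:
  assumes "\<beta> \<in> words B" "concat \<beta> \<in> normal_words A R" "\<beta> \<noteq> dec (concat \<beta>)"
  shows "(cut_marks (dec (concat \<beta>)), cut_marks \<beta>) \<in> lex less_than"
  using assms
proof (induction \<beta>)
  case (Cons b \<beta>)
  let ?w = "concat (b # \<beta>)"
  define n where "n = (LEAST n. cut ?w n)"
  have w: "?w \<in> L" using concat_B_L Cons.prems(1,2) .
  have dec: "dec ?w = take n ?w # dec (drop n ?w)"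
    using w dec.simps[of ?w] by (simp add: n_def)
  have n: "cut ?w n" using cut_Least[OF w] by (simp add: n_def)
  have n_le: "n \<le> length b"
    unfolding n_def using dec_Cons[OF Cons.prems(1,2)] by (rule Least_le)
  show ?case
  proof (cases "n = length b")
    case True
    then have dec': "dec ?w = b # dec (concat \<beta>)" using dec by simp
    have "\<beta> \<noteq> []" using Cons.prems(3) dec' by (auto simp: dec.simps[of "[]"] Nil_notin_L)
    then have \<beta>: "\<beta> \<in> words B" using Cons.prems(1) by (simp add: in_words_iff)
    then have "concat \<beta> \<in> normal_words A R"
      using concat_B(1)[OF \<beta>] Cons.prems(2) normal_words_factor[of b "concat \<beta>" "[]" A R]
      by (simp add: in_words_iff)
    with Cons.IH \<beta> Cons.prems(3) dec' have "(cut_marks (dec (concat \<beta>)), cut_marks \<beta>) \<in> lex less_than"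
      by auto
    from lex_context[OF this, of "cut_marks [b]" "[]"] show ?thesis
      unfolding dec' by (simp add: cut_marks_append[symmetric])
  next
    case False
    with n_le have less: "n < length b" by simp
    have "0 < n" using cut_pos[OF n] by simp
    have 1: "cut_marks (dec ?w) = replicate (n - 1) 1 @ 0 # cut_marks (dec (drop n ?w))"
      unfolding dec using less by (simp add: cut_marks_def)
    have "replicate (length b - 1) (1::nat) = replicate (n - 1) 1 @ 1 # replicate (length b - 1 - n) 1"
    proof -
      have "length b - 1 = (n - 1) + Suc (length b - 1 - n)" using less \<open>0 < n\<close> by simp
      then show ?thesis by (metis replicate_Suc replicate_add)
    qed
    then have 2: "cut_marks (b # \<beta>) =
        replicate (n - 1) 1 @ 1 # (replicate (length b - 1 - n) 1 @ 0 # cut_marks \<beta>)"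
      by (simp add: cut_marks_def)
    \<comment> \<open>\<open>lex\<close> relates only lists of equal length; here both lengths are
      that of the common word.\<close>
    have "[] \<notin> set (dec ?w)" "[] \<notin> set (b # \<beta>)"
      using dec_words[OF w] Cons.prems(1) unfolding in_words_iff by (blast dest: set_subset_BD)+
    then have "length (cut_marks (dec ?w)) = length (cut_marks (b # \<beta>))"
      by (simp only: length_cut_marks concat_dec[OF w] not_False_eq_True)
    with 1 2 show ?thesis
      unfolding lex_conv by fastforce
  qed
qed (simp add: in_words_iff)

text \<open>If \<open>\<beta>\<close> could be cut inside its first block \<open>b\<close>, then so could its first \<open>N + 1\<close> blocks,
  since what remains of them after the cut is longer than \<open>N\<close>.\<close>

lemma dec_local:
  assumes "\<beta> \<in> words B" "concat \<beta> \<in> normal_words A R"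
    and "\<And>p \<gamma> q. \<beta> = p @ \<gamma> @ q \<Longrightarrow> \<gamma> \<noteq> [] \<Longrightarrow> length \<gamma> \<le> N + 1 \<Longrightarrow> dec (concat \<gamma>) = \<gamma>"
  shows "dec (concat \<beta>) = \<beta>"
  using assms
proof (induction \<beta>)
  case (Cons b \<beta>)
  let ?w = "concat (b # \<beta>)"
  show ?case
  proof (cases "length (b # \<beta>) \<le> N + 1")
    case True
    then show ?thesis using Cons.prems(3)[of "[]" "b # \<beta>" "[]"] by simp
  next
    case False
    define n where "n = (LEAST n. cut ?w n)"
    have w: "?w \<in> L" using concat_B_L Cons.prems(1,2) .
    have dec: "dec ?w = take n ?w # dec (drop n ?w)"
      using w dec.simps[of ?w] by (simp add: n_def)
    have n: "cut ?w n" using cut_Least[OF w] by (simp add: n_def)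
    have n_le: "n \<le> length b"
      unfolding n_def using dec_Cons[OF Cons.prems(1,2)] by (rule Least_le)
    have "\<not> n < length b"
    proof
      assume less: "n < length b"
      define \<gamma> where "\<gamma> = b # take N \<beta>"
      define z where "z = concat \<gamma>"
      have split: "b # \<beta> = [] @ \<gamma> @ drop N \<beta>" by (simp add: \<gamma>_def)
      have "length \<gamma> \<le> N + 1" by (simp add: \<gamma>_def)
      with Cons.prems(3)[OF split] have \<gamma>: "dec z = \<gamma>" by (simp add: z_def \<gamma>_def)
      have wz: "?w = z @ concat (drop N \<beta>)"
        unfolding z_def by (metis split append_Nil concat_append)
      have "[] \<notin> set (take N \<beta>)"
        using Cons.prems(1) set_subset_BD[of "b # \<beta>"] by (auto simp: in_words_iff dest: in_set_takeD)
      from length_le_length_concat[OF this] have len: "length b + N \<le> length z"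
        using False by (simp add: z_def \<gamma>_def)
      have "drop n z \<in> L"
      proof (rule long_factor_L[of "take n z" _ "concat (drop N \<beta>)"])
        show "take n z @ drop n z @ concat (drop N \<beta>) \<in> normal_words A R"
          using Cons.prems(2) unfolding wz by (simp only: append_assoc[symmetric] append_take_drop_id)
      qed (use len less in simp)
      moreover have "take n z \<in> B"
        using n less len unfolding wz cut_def by simp
      ultimately have "cut z n" by (simp add: cut_def)
      then have "(LEAST n. cut z n) < length b"
        using less by (meson Least_le le_less_trans)
      \<comment> \<open>By the window hypothesis \<open>dec z\<close> starts with \<open>b\<close>,
        whereas the cut at \<open>n\<close> forces a shorter first block.\<close>
      moreover have "z \<in> L" using \<gamma> dec.simps[of z] by (auto simp: \<gamma>_def split: if_splits)
      ultimately have "length (hd (dec z)) < length b"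
        by (simp add: dec.simps[of z] min_def)
      then show False by (simp add: \<gamma>) (simp add: \<gamma>_def)
    qed
    with n_le have "n = length b" by simp
    with dec have dec': "dec ?w = b # dec (concat \<beta>)" by simp
    have \<beta>: "\<beta> \<in> words B" using Cons.prems(1) False by (auto simp: in_words_iff)
    then have "concat \<beta> \<in> normal_words A R"
      using concat_B(1)[OF \<beta>] Cons.prems(2) normal_words_factor[of b "concat \<beta>" "[]" A R]
      by (simp add: in_words_iff)
    moreover have "dec (concat \<gamma>) = \<gamma>" if "\<beta> = p @ \<gamma> @ q" "\<gamma> \<noteq> []" "length \<gamma> \<le> N + 1" for p \<gamma> q
      using that Cons.prems(3)[of "b # p" \<gamma> q] by simp
    ultimately show ?thesis using Cons.IH \<beta> dec' by simp
  qed
qed (simp add: in_words_iff)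

section \<open>The rewriting system on blocks\<close>

definition nf :: "'a \<Rightarrow> 'b list" where
  "nf t = (SOME w. w \<in> normal_words A R \<and> word_prod \<psi> w = t)"

lemma nf: "nf t \<in> normal_words A R" "word_prod \<psi> (nf t) = t"
proof -
  obtain w where "w \<in> words A" "word_prod \<psi> w = t" using surj by (metis UNIV_I imageE)
  with ex_normal sound_steps have "\<exists>w. w \<in> normal_words A R \<and> word_prod \<psi> w = t" by metis
  from someI_ex[OF this] show "nf t \<in> normal_words A R" "word_prod \<psi> (nf t) = t"
    by (auto simp: nf_def)
qed

lemma nf_word_prod: "w \<in> normal_words A R \<Longrightarrow> nf (word_prod \<psi> w) = w"
  using inj_onD[OF inj _ nf(1)] nf(2) by metis

lemma nf_steps:
  assumes "w \<in> words A"
  shows "(w, nf (word_prod \<psi> w)) \<in> (rstep A R)\<^sup>*"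
  using ex_normal[OF assms] nf_word_prod sound_steps by metis

definition canon :: "'b list list \<Rightarrow> 'b list list" where
  "canon \<beta> = dec (nf (word_prod \<psi> (concat \<beta>)))"

text \<open>The bound \<open>N + 1\<close> is the window of \<open>dec_local\<close>, a block and
  its \<open>N\<close> successors; it also covers the at most \<open>N\<close> blocks needed to see
  a left side of \<open>R\<close>. Leaving out sequences that are already canonical avoids trivial
  loops.\<close>

definition block_rules :: "('b list list \<times> 'b list list) set" where
  "block_rules = (\<lambda>\<beta>. (\<beta>, canon \<beta>)) ` {\<beta> \<in> words B. length \<beta> \<le> N + 1 \<and> canon \<beta> \<noteq> \<beta>}"

lemma nf_L: "t \<in> T \<Longrightarrow> nf t \<in> L"
  using nf by (simp add: L_def)

lemma canon:
  assumes "\<beta> \<in> words B"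
  shows "canon \<beta> \<in> words B" "concat (canon \<beta>) = nf (word_prod \<psi> (concat \<beta>))"
  using nf_L[OF concat_B(2)[OF assms]] dec_words concat_dec by (auto simp: canon_def)

lemma word_prod_blocks:
  "\<beta> \<in> words B \<Longrightarrow> word_prod (word_prod \<psi>) \<beta> = word_prod \<psi> (concat \<beta>)"
  using set_subset_BD by (simp add: in_words_iff word_prod_concat)

lemma block_rulesE:
  assumes "(\<beta>, \<gamma>) \<in> block_rules"
  obtains "\<beta> \<in> words B" "length \<beta> \<le> N + 1" "\<gamma> = canon \<beta>" "\<gamma> \<noteq> \<beta>"
  using assms by (auto simp: block_rules_def)

text \<open>If the concatenation of the replaced blocks was reducible, normalising it takes at least
  one step of \<open>R\<close>, which lifts to the whole word. Otherwise only the factorisation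
  changes, from a non-greedy to the greedy one, and \<open>dec_least\<close> applies.\<close>

lemma block_step_decreases:
  assumes "(u, v) \<in> rstep B block_rules"
  shows "(concat u, concat v) \<in> (rstep A R)\<^sup>+ \<or>
    concat v = concat u \<and> (cut_marks v, cut_marks u) \<in> lex less_than"
proof -
  obtain p q \<beta> \<gamma> where uv: "u = p @ \<beta> @ q" "v = p @ \<gamma> @ q" and r: "(\<beta>, \<gamma>) \<in> block_rules"
    and pq: "set p \<subseteq> B" "set q \<subseteq> B"
    using assms by (rule rstepE)
  from r have \<beta>: "\<beta> \<in> words B" "\<gamma> = canon \<beta>" "\<gamma> \<noteq> \<beta>" by (auto elim: block_rulesE)
  have "(concat \<beta>, concat \<gamma>) \<in> (rstep A R)\<^sup>*"
    using nf_steps concat_B(1)[OF \<beta>(1)] canon(2)[OF \<beta>(1)] \<beta>(2) by simp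
  then consider "concat \<gamma> = concat \<beta>" | "(concat \<beta>, concat \<gamma>) \<in> (rstep A R)\<^sup>+"
    by (metis rtranclD)
  then show ?thesis
  proof cases
    case 1
    with canon(2)[OF \<beta>(1)] \<beta>(2) have eq: "nf (word_prod \<psi> (concat \<beta>)) = concat \<beta>" by simp
    with nf(1) have "concat \<beta> \<in> normal_words A R" by metis
    moreover have "\<gamma> = dec (concat \<beta>)" using \<beta>(2) eq by (simp add: canon_def)
    ultimately have "(cut_marks \<gamma>, cut_marks \<beta>) \<in> lex less_than"
      using dec_least[OF \<beta>(1)] \<beta>(3) by metis
    from lex_context[OF this] 1 show ?thesis by (simp add: uv cut_marks_append)
  next
    case 2
    have "set (concat p) \<subseteq> A" "set (concat q) \<subseteq> A"
      using pq by (auto simp: B_def L_def normal_words_def in_words_iff)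
    from rsteps_context[OF 2 this] show ?thesis by (simp add: uv)
  qed
qed

lemma wf_block_step: "wf ((rstep B block_rules)\<inverse>)"
proof (rule wf_subset)
  show "wf (inv_image ((((rstep A R)\<^sup>+)\<inverse>) <*lex*> lex less_than) (\<lambda>u. (concat u, cut_marks u)))"
    using wf_trancl[OF wf_step] by (intro wf_inv_image wf_lex_prod wf_lex) (auto simp: trancl_converse)
  show "(rstep B block_rules)\<inverse> \<subseteq> inv_image ((((rstep A R)\<^sup>+)\<inverse>) <*lex*> lex less_than) (\<lambda>u. (concat u, cut_marks u))"
    using block_step_decreases by fastforce
qed

text \<open>Every window of at most \<open>N + 1\<close> blocks is canonical, so its concatenation
  is irreducible. A redex of the whole concatenation would already occur in such a window by
  \<open>concat_window\<close>; greediness then follows from \<open>dec_local\<close>.\<close>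

lemma block_normal:
  assumes \<beta>: "\<beta> \<in> normal_words B block_rules"
  shows "concat \<beta> \<in> normal_words A R" "dec (concat \<beta>) = \<beta>"
proof -
  have B: "\<beta> \<in> words B" using \<beta> by (simp add: normal_words_def)
  have window: "canon \<gamma> = \<gamma> \<and> concat \<gamma> \<in> normal_words A R"
    if split: "\<beta> = p @ \<gamma> @ q" "\<gamma> \<noteq> []" "length \<gamma> \<le> N + 1" for p \<gamma> q
  proof -
    have \<gamma>: "\<gamma> \<in> words B" using B split by (simp add: in_words_iff)
    have "canon \<gamma> = \<gamma>"
    proof (rule ccontr)
      assume "canon \<gamma> \<noteq> \<gamma>"
      then have "(\<gamma>, canon \<gamma>) \<in> block_rules"
        using \<gamma> split(3) by (simp add: block_rules_def)
      from rstepI[OF this, of p B q] B split(1) have "\<beta> \<in> Domain (rstep B block_rules)"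
        by (auto simp: in_words_iff)
      with \<beta> show False by (simp add: normal_words_def)
    qed
    with canon(2)[OF \<gamma>] nf(1) show ?thesis by metis
  qed
  show normal: "concat \<beta> \<in> normal_words A R"
  proof (rule ccontr)
    assume "concat \<beta> \<notin> normal_words A R"
    with concat_B(1)[OF B] obtain w where "(concat \<beta>, w) \<in> rstep A R"
      by (auto simp: normal_words_def)
    then obtain p q X Y where *: "concat \<beta> = p @ X @ q" "(X, Y) \<in> R" "set p \<subseteq> A" "set q \<subseteq> A"
      by (rule rstepE)
    have "X \<noteq> []" using *(2) rules by (auto simp: rewriting_system_def in_words_iff)
    obtain \<beta>\<^sub>1 \<gamma> \<beta>\<^sub>2 p' q' where w: "\<beta> = \<beta>\<^sub>1 @ \<gamma> @ \<beta>\<^sub>2" "length \<gamma> \<le> length X" "concat \<gamma> = p' @ X @ q'"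
      using concat_window[OF *(1) set_subset_BD \<open>X \<noteq> []\<close>] B unfolding in_words_iff by blast
    with \<open>X \<noteq> []\<close> have "\<gamma> \<noteq> []" by auto
    with window[OF w(1)] w(2) lhs[OF *(2)] have c: "concat \<gamma> \<in> normal_words A R" by simp
    with w(3) rstepI[OF *(2), of p' A q'] show False
      by (auto simp: normal_words_def in_words_iff)
  qed
  show "dec (concat \<beta>) = \<beta>"
  proof (rule dec_local[OF B normal])
    fix p \<gamma> q assume "\<beta> = p @ \<gamma> @ q" "\<gamma> \<noteq> []" "length \<gamma> \<le> N + 1"
    \<comment> \<open>\<open>nf\<close> fixes the irreducible word \<open>concat \<gamma>\<close>,
      so \<open>canon \<gamma>\<close> is just its greedy factorisation.\<close>
    from window[OF this] show "dec (concat \<gamma>) = \<gamma>"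
      by (metis canon_def nf_word_prod)
  qed
qed

lemma block_presentation: "complete_presentation T B block_rules (word_prod \<psi>)"
proof
  show "finite B" by (rule finite_B)
  have "{\<beta> \<in> words B. length \<beta> \<le> N + 1 \<and> canon \<beta> \<noteq> \<beta>} \<subseteq> {\<beta>. set \<beta> \<subseteq> B \<and> length \<beta> \<le> N + 1}"
    by (auto simp: in_words_iff)
  then show "finite block_rules"
    unfolding block_rules_def
    using finite_lists_length_le[OF finite_B] by (meson finite_imageI finite_subset)
  show "rewriting_system B block_rules"
    using canon(1) by (auto simp: rewriting_system_def elim: block_rulesE)
  show "wf ((rstep B block_rules)\<inverse>)" by (rule wf_block_step)
  show "word_prod (word_prod \<psi>) X = word_prod (word_prod \<psi>) Y" if "(X, Y) \<in> block_rules" for X Y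
    using that by (auto elim!: block_rulesE simp: word_prod_blocks canon nf)
  show "word_prod (word_prod \<psi>) ` words B = T"
  proof
    show "word_prod (word_prod \<psi>) ` words B \<subseteq> T"
      using concat_B(2) by (auto simp: word_prod_blocks)
    show "T \<subseteq> word_prod (word_prod \<psi>) ` words B"
    proof
      fix t assume "t \<in> T"
      from nf_L[OF this] have "dec (nf t) \<in> words B" "word_prod (word_prod \<psi>) (dec (nf t)) = t"
        by (simp_all add: dec_words word_prod_blocks concat_dec nf)
      then show "t \<in> word_prod (word_prod \<psi>) ` words B" by (metis imageI)
    qed
  qed
  \<comment> \<open>The value determines the irreducible underlying word, and that word determines
    its greedy factorisation.\<close>
  show "inj_on (word_prod (word_prod \<psi>)) (normal_words B block_rules)"
  proof (rule inj_onI)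
    fix u v assume u: "u \<in> normal_words B block_rules" and v: "v \<in> normal_words B block_rules"
      and "word_prod (word_prod \<psi>) u = word_prod (word_prod \<psi>) v"
    then have "word_prod \<psi> (concat u) = word_prod \<psi> (concat v)"
      by (simp add: normal_words_def word_prod_blocks)
    then have "concat u = concat v"
      using inj_onD[OF inj] block_normal(1) u v by blast
    then show "u = v" using block_normal(2) u v by metis
  qed
qed

end

lemma large_subsemigroup_has_finite_complete_rs:
  fixes T :: "'a::semigroup_mult set"
  assumes T: "subsemigroup T" and fin: "finite (UNIV - T)"
    and "has_finite_complete_rs (UNIV :: 'a set)"
  shows "has_finite_complete_rs T"
proof -
  obtain A :: "nat set" and R and \<psi> :: "nat \<Rightarrow> 'a" where pres: "complete_presentation UNIV A R \<psi>"
    using assms(3) by (rule has_finite_complete_rsE)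
  interpret complete_presentation UNIV A R \<psi> by (rule pres)
  define F where "F = {w \<in> normal_words A R. word_prod \<psi> w \<notin> T}"
  \<comment> \<open>Distinct irreducible words have distinct values, and only finitely many values
    lie outside \<open>T\<close>.\<close>
  have "finite F"
  proof (rule finite_imageD)
    show "finite (word_prod \<psi> ` F)" by (rule finite_subset[OF _ fin]) (auto simp: F_def)
    show "inj_on (word_prod \<psi>) F" by (rule inj_on_subset[OF inj]) (auto simp: F_def)
  qed
  \<comment> \<open>Inserting 0 keeps \<open>Max\<close> meaningful when \<open>F\<close> and
    \<open>R\<close> are both empty.\<close>
  define N where "N = Max (insert 0 (length ` (F \<union> fst ` R)))"
  have N: "length w \<le> N" if "w \<in> F \<union> fst ` R" for w
    unfolding N_def using that \<open>finite F\<close> finite_rules by (intro Max_ge) auto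
  interpret large_subsemigroup A R \<psi> T N
  proof
    show "word_prod \<psi> w \<in> T" if "w \<in> normal_words A R" "N < length w" for w
      using that N[of w] by (auto simp: F_def)
    show "length X \<le> N" if "(X, Y) \<in> R" for X Y
      using N[of X] that by force
  qed (rule T)
  show ?thesis
    using has_finite_complete_rsI[OF block_presentation] T by (simp add: subsemigroup_def)
qed

theorem corollary1p2:
  fixes T :: "'a::semigroup_mult set"
  assumes "subsemigroup T"
    and "finite (UNIV - T)"
  shows "has_finite_complete_rs (UNIV :: 'a set) \<longleftrightarrow> has_finite_complete_rs T"
  using assms large_subsemigroup_has_finite_complete_rs small_extension_has_finite_complete_rs
  by blast

end
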